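(* Consider the piecewise-smooth system $\dot x = F^L(x;\mu)$ for $x_1<0$, $\dot x = F^R(x;\mu)$ for $x_1>0$, with $x\in\mathbb{R}^n$, $\mu\in\mathbb{R}$, where $F^L$ and $F^R$ have continuous second derivatives and, near $(x;\mu)=(\mathbf 0,0)$, $$F^L(x;\mu)=Ax+b\mu+\mathcal O(2),\qquad F^R(x;\mu)=c+\mathcal O(1),$$ with $A\in\mathbb{R}^{n\times n}$ and $b,c\in\mathbb{R}^n$. Let $\tilde M$ be the lower-right $(n-1)\times(n-1)$ block of $M=\left(I-\frac{c\,e_1^{\mathsf T}}{c_1}\right)A$. Suppose $\det(A)\neq 0$, $\det(\tilde M)\neq 0$, $c_1\neq 0$, and $\alpha_L\neq 0$, where $\alpha_L,\alpha_S\in\mathbb{R}$ are defined by $$x^L_1(\mu)=\alpha_L\mu+\mathcal O(\mu^2),\qquad \chi(x^S(\mu);\mu)=\alpha_S\mu+\mathcal O(\mu^2).$$ Here $x^L(\mu)$ is the unique local regular equilibrium, $x^S(\mu)$ is the unique local pseudo-equilibrium, and $\chi=F^L_1F^R_1$. Then $$\operatorname{sgn}(\alpha_L\alpha_S)=(-1)^{N_L+N_S}\,\operatorname{sgn}(c_1),$$ where $N_L$ is the number of real positive eigenvalues of $A$ and $N_S$ is the number of real positive eigenvalues of $\tilde M$.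
   Context: Notation: $e_1,\dots,e_n$ is the standard basis of $\mathbb{R}^n$; $\mathbf 0$ is the zero vector; subscripts on vectors denote components; $\mathcal O(k)$ denotes terms of order $k$ or greater in $x$ and $\mu$; $\operatorname{sgn}(a)=-1,0,1$ for $a<0$, $a=0$, $a>0$ respectively. Eigenvalues are counted with algebraic multiplicity. For $n=1$, $\tilde M$ is the empty matrix, with determinant $1$ and no eigenvalues. The discontinuity surface is $\Sigma=\{x\in\mathbb{R}^n : x_1=0\}$. The sliding vector field on $\Sigma$ is $$F^S=\frac{F^L_1F^R-F^R_1F^L}{F^L_1-F^R_1},$$ which is well defined near $(\mathbf 0,0)$ when $c_1\ne0$ (and has first component $0$). A regular equilibrium is a point $x\in\mathbb{R}^n$ with $F^L(x;\mu)=\mathbf 0$ or $F^R(x;\mu)=\mathbf 0$. A pseudo-equilibrium is a point $x\in\Sigma$ with $F^S(x;\mu)=\mathbf 0$. (Neither definition requires admissibility.) If $\det(A)\neq0$ and $c_1\ne 0$, then in a neighbourhood of $(\mathbf 0,0)$ there is a unique regular equilibrium $x^L(\mu)$; it satisfies $F^L(x^L(\mu);\mu)=\mathbf 0$ and $x^L(\mu)=-A^{-1}b\mu+\mathcal O(\mu^2)$. If $\det(\tilde M)\neq0$ and $c_1\ne0$, then in a neighbourhood of $(\mathbf 0,0)$ there is a unique pseudo-equilibrium $x^S(\mu)$, and $x^S(0)=\mathbf 0$. *)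

theory Defs
  imports
    "HOL-Analysis.Analysis"
    "HOL-Library.Landau_Symbols"
    "Jordan_Normal_Form.Char_Poly"
begin

no_notation vec_index (infixl \<open>$\<close> 100)
no_notation scalar_prod (infix \<open>\<bullet>\<close> 70)

type_synonym 'n rvec = "real ^ 'n"
type_synonym 'n rmat = "real ^ 'n ^ 'n"

(* Vector fields are functions of the pair (x, \<mu>). *)
type_synonym 'n field_family = "'n rvec \<times> real \<Rightarrow> 'n rvec"

(* The components x_1, ..., x_n of x :: real^'n are x $ coord 0, ..., x $ coord (n - 1),
   where n = CARD('n) and the index type is enumerated in increasing order. *)
definition coord :: "nat \<Rightarrow> 'n::{finite,linorder}" where
  "coord i = sorted_list_of_set (UNIV :: 'n set) ! i"

definition e1 :: "'n::{finite,linorder} rvec" where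
  "e1 = axis (coord 0) 1"

(* Passage to matrices with natural-number dimensions: a block with n - 1 rows has no index type
   depending uniformly on 'n, and none at all when n = 1. *)
definition to_mat :: "'n::{finite,linorder} rmat \<Rightarrow> real Matrix.mat" where
  "to_mat B = Matrix.mat CARD('n) CARD('n) (\<lambda>(i, j). B $ coord i $ coord j)"

(* M = (I - c e_1^T / c_1) A *)
definition M_matrix :: "'n::{finite,linorder} rmat \<Rightarrow> 'n rvec \<Rightarrow> 'n rmat" where
  "M_matrix A c =
     (Finite_Cartesian_Product.mat 1
       - (1 / c $ coord 0) *\<^sub>R (\<chi> i j. c $ i * e1 $ j)) ** A"

(* The lower-right (n - 1) x (n - 1) block of M; it is the empty matrix when n = 1. *)
definition M_block :: "'n::{finite,linorder} rmat \<Rightarrow> 'n rvec \<Rightarrow> real Matrix.mat" where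
  "M_block A c = mat_delete (to_mat (M_matrix A c)) 0 0"

(* Number of real positive eigenvalues, counted with algebraic multiplicity. *)
definition num_pos_eigenvalues :: "real Matrix.mat \<Rightarrow> nat" where
  "num_pos_eigenvalues B =
     (\<Sum>x | x > 0 \<and> eigenvalue B x. Polynomial.order x (char_poly B))"

definition C2_on ::
  "'a::real_normed_vector set \<Rightarrow> ('a \<Rightarrow> 'b::real_normed_vector) \<Rightarrow> bool" where
  "C2_on U F \<longleftrightarrow>
     (\<exists>(F' :: 'a \<Rightarrow> 'a \<Rightarrow>\<^sub>L 'b) (F'' :: 'a \<Rightarrow> 'a \<Rightarrow>\<^sub>L 'a \<Rightarrow>\<^sub>L 'b).
        (\<forall>z\<in>U. (F has_derivative blinfun_apply (F' z)) (at z)) \<and>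
        (\<forall>z\<in>U. (F' has_derivative blinfun_apply (F'' z)) (at z)) \<and>
        continuous_on U F'')"

definition sliding_field ::
  "'n::{finite,linorder} field_family \<Rightarrow> 'n field_family \<Rightarrow> 'n field_family" where
  "sliding_field FL FR z =
     (1 / (FL z $ coord 0 - FR z $ coord 0)) *\<^sub>R
       ((FL z $ coord 0) *\<^sub>R FR z - (FR z $ coord 0) *\<^sub>R FL z)"

definition regular_equilibrium ::
  "'n::{finite,linorder} field_family \<Rightarrow> 'n field_family \<Rightarrow> 'n rvec \<Rightarrow> real \<Rightarrow> bool" where
  "regular_equilibrium FL FR x \<mu> \<longleftrightarrow> FL (x, \<mu>) = 0 \<or> FR (x, \<mu>) = 0"

(* The inequality says that the sliding vector field is defined at (x, \<mu>); without it the
   convention 1 / 0 = 0 would add spurious zeros. *)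
definition pseudo_equilibrium ::
  "'n::{finite,linorder} field_family \<Rightarrow> 'n field_family \<Rightarrow> 'n rvec \<Rightarrow> real \<Rightarrow> bool" where
  "pseudo_equilibrium FL FR x \<mu> \<longleftrightarrow>
     x $ coord 0 = 0 \<and>
     FL (x, \<mu>) $ coord 0 \<noteq> FR (x, \<mu>) $ coord 0 \<and>
     sliding_field FL FR (x, \<mu>) = 0"

definition chi ::
  "'n::{finite,linorder} field_family \<Rightarrow> 'n field_family \<Rightarrow> 'n rvec \<times> real \<Rightarrow> real" where
  "chi FL FR z = FL z $ coord 0 * FR z $ coord 0"

(* For \<mu> near 0, X \<mu> is the unique point with property P in a fixed neighbourhood of 0. *)
definition unique_local_branch ::
  "('a::real_normed_vector \<Rightarrow> real \<Rightarrow> bool) \<Rightarrow> (real \<Rightarrow> 'a) \<Rightarrow> bool" where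
  "unique_local_branch P X \<longleftrightarrow>
     (\<exists>V W. open V \<and> 0 \<in> V \<and> open W \<and> 0 \<in> W \<and>
        (\<forall>\<mu>\<in>W. X \<mu> \<in> V \<and> (\<forall>x\<in>V. P x \<mu> \<longleftrightarrow> x = X \<mu>)))"

end

theory Submission
  imports Defs
begin

text \<open>
  Both branches are zeros of maps of the form \<open>F(x, \<mu>) = B x + \<mu> b + O(2)\<close> with \<open>B\<close> invertible, so they
  equal \<open>- \<mu> B\<^sup>-\<^sup>1 b + O(\<mu>\<^sup>2)\<close>. For the regular equilibrium \<open>F = F\<^sup>L\<close>. For the pseudo-equilibrium
  \<open>F\<close> is \<open>- (F\<^sup>L\<^sub>1 F\<^sup>R - F\<^sup>R\<^sub>1 F\<^sup>L) / c\<^sub>1\<close> with its vanishing first component replaced by \<open>x\<^sub>1\<close>; the linear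
  part is then \<open>M\<close> with first row \<open>e\<^sub>1\<^sup>T\<close>, whose determinant is that of the block \<open>M~\<close>.
  On the sliding branch \<open>v \<mu>\<close> one has \<open>A v + b = t c\<close>, hence \<open>\<alpha>\<^sub>S = c\<^sub>1\<^sup>2 t\<close>, while \<open>v\<^sub>1 = 0\<close> gives
  \<open>\<alpha>\<^sub>L = - t (A\<^sup>-\<^sup>1 c)\<^sub>1 = - t c\<^sub>1 det M~ / det A\<close>. So \<open>\<alpha>\<^sub>L \<alpha>\<^sub>S\<close> has the sign of
  \<open>- c\<^sub>1 det A det M~\<close>, and the sign of a determinant is read off the number of positive roots
  of the characteristic polynomial.
\<close>


section \<open>Signs of determinants from positive eigenvalues\<close>

text \<open>Splitting off a factor \<open>x - a\<close> with \<open>a > 0\<close> flips the sign at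
  0, keeps the leading coefficient and lowers the sum of orders by one. Without positive roots,
  \<open>p\<close> has at 0 the sign it has near infinity.\<close>

lemma sgn_poly_0_eq_num_pos_roots:
  fixes p :: "real poly"
  assumes "lead_coeff p > 0" and "poly p 0 \<noteq> 0"
  shows "sgn (poly p 0) = (-1) ^ (\<Sum>x | x > 0 \<and> poly p x = 0. Polynomial.order x p)"
  using assms
proof (induction "degree p" arbitrary: p rule: less_induct)
  case less
  have p0: "p \<noteq> 0" using less.prems by auto
  show ?case
  proof (cases "\<exists>a>0. poly p a = 0")
    case False
    have "poly p 0 > 0"
    proof (rule ccontr)
      assume "\<not> poly p 0 > 0"
      then have neg: "poly p 0 < 0" using less.prems by auto
      obtain m where m: "\<forall>x\<ge>m. poly p x \<ge> lead_coeff p"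
        using poly_pinfty_gt_lc[OF less.prems(1)] by blast
      \<comment> \<open>\<open>m\<close> may be negative; the maximum with 1 puts the point to the
        right of 0, as the intermediate value theorem requires.\<close>
      have "poly p (max m 1) > 0" using m less.prems(1) by (meson less_le_trans max.cobounded1)
      from poly_IVT_pos[OF _ neg this] False show False by force
    qed
    moreover have none: "{x. x > 0 \<and> poly p x = 0} = {}" using False by auto
    ultimately show ?thesis unfolding none by simp
  next
    case True
    then obtain a where a: "a > 0" "poly p a = 0" by auto
    then obtain q where q: "p = [:-a, 1:] * q" using poly_eq_0_iff_dvd by (metis dvdE)
    have q0: "q \<noteq> 0" using p0 q by auto
    have deg: "degree q < degree p" using q0 degree_mult_eq[of "[:-a, 1:]" q] by (simp add: q del: mult_pCons_left)
    have "lead_coeff p = lead_coeff q" unfolding q lead_coeff_mult by simp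
    then have lc: "lead_coeff q > 0" using less.prems by simp
    have pq: "poly p 0 = - a * poly q 0" unfolding q by simp
    have qnz: "poly q 0 \<noteq> 0" using less.prems pq by auto
    let ?R = "{x. x > 0 \<and> poly p x = 0}"
    have fin: "finite ?R" using poly_roots_finite[OF p0] by (rule finite_subset[rotated]) auto
    have order: "Polynomial.order x p = (if x = a then 1 else 0) + Polynomial.order x q" for x
    proof -
      have "Polynomial.order x [:-a, 1:] = (if x = a then 1 else 0)"
        using order_power_n_n[of a 1] by (auto intro: order_0I)
      then show ?thesis using p0 unfolding q by (subst order_mult) auto
    qed
    have "(\<Sum>x\<in>?R. Polynomial.order x p) = 1 + (\<Sum>x\<in>?R. Polynomial.order x q)"
      using a fin by (simp add: order sum.distrib)
    \<comment> \<open>Every positive root of \<open>q\<close> lies in \<open>?R\<close>. The only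
      other possible element is \<open>a\<close>, which contributes order 0 if it is not a root of
      \<open>q\<close>.\<close>
    also have "(\<Sum>x\<in>?R. Polynomial.order x q) = (\<Sum>x | x > 0 \<and> poly q x = 0. Polynomial.order x q)"
      using fin by (intro sum.mono_neutral_right) (auto simp: q order_root)
    finally show ?thesis
      using less.hyps[OF deg lc qnz] a by (simp add: pq sgn_mult)
  qed
qed

text \<open>The characteristic polynomial is monic with value
  \<open>det (- B) = (-1)^n det B\<close> at 0, and its roots are the eigenvalues.\<close>

lemma sgn_det_eq_num_pos_eigenvalues:
  fixes B :: "real Matrix.mat"
  assumes B: "B \<in> carrier_mat n n" and nz: "Determinant.det B \<noteq> 0"
  shows "sgn (Determinant.det B) = (-1) ^ (n + num_pos_eigenvalues B)"
proof -
  have "- (char_matrix B 0) = (-1) \<cdot>\<^sub>m B"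
    using B by (intro eq_matI) (auto simp: char_matrix_def)
  then have p0: "poly (char_poly B) 0 = (-1) ^ n * Determinant.det B"
    using B by (simp add: char_poly_matrix[OF B])
  have "sgn (poly (char_poly B) 0) = (-1) ^ num_pos_eigenvalues B"
    unfolding num_pos_eigenvalues_def eigenvalue_root_char_poly[OF B]
    using degree_monic_char_poly[OF B] nz by (intro sgn_poly_0_eq_num_pos_roots) (auto simp: p0)
  then have "(-1) ^ n * sgn (Determinant.det B) = (-1) ^ num_pos_eigenvalues B"
    by (cases "even n") (simp_all add: p0 sgn_mult)
  then show ?thesis by (cases "even n") (auto simp: power_add)
qed

section \<open>Determinants under renumbering of indices, and the block of \<open>M\<close>\<close>

lemma coord_bij_betw:
  "bij_betw coord {0..<CARD('n)} (UNIV :: 'n::{finite,linorder} set)"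
  unfolding coord_def
  by (rule bij_betw_nth) (auto simp: lessThan_atLeast0)

lemma coord_eq_iff:
  "i < CARD('n) \<Longrightarrow> j < CARD('n) \<Longrightarrow> (coord i :: 'n::{finite,linorder}) = coord j \<longleftrightarrow> i = j"
  using bij_betw_imp_inj_on[OF coord_bij_betw[where ?'n='n]] by (auto simp: inj_on_eq_iff)

lemma to_mat_carrier: "to_mat (B :: 'n::{finite,linorder} rmat) \<in> carrier_mat CARD('n) CARD('n)"
  by (simp add: to_mat_def)

lemma to_mat_index:
  "i < CARD('n) \<Longrightarrow> j < CARD('n) \<Longrightarrow>
    to_mat (B :: 'n::{finite,linorder} rmat) $$ (i, j) = B $ coord i $ coord j"
  by (simp add: to_mat_def)

text \<open>The two Leibniz sums agree term by term: transporting a permutation along the bijection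
  \<open>coord\<close> preserves its sign and permutes the factors of each product.\<close>

lemma det_to_mat: "Determinant.det (to_mat B) = Determinants.det (B :: 'n::{finite,linorder} rmat)"
proof -
  let ?n = "CARD('n)" and ?f = "coord :: nat \<Rightarrow> 'n"
  let ?m = "map_permutation {0..<?n} ?f"
  let ?g = "inv_into {0..<?n} ?f"
  have f: "bij_betw ?f {0..<?n} UNIV" by (rule coord_bij_betw)
  then have g: "bij_betw ?g UNIV {0..<?n}" by (rule bij_betw_inv_into)
  have inj: "inj_on ?f {0..<?n}" using f by (rule bij_betw_imp_inj_on)
  have "Determinant.det (to_mat B) =
      (\<Sum>p | p permutes {0..<?n}. signof p * (\<Prod>i = 0..<?n. to_mat B $$ (i, p i)))"
    by (rule det_def'[OF to_mat_carrier])
  also have "\<dots> = (\<Sum>p | p permutes (UNIV :: 'n set). of_int (sign p) * (\<Prod>i\<in>UNIV. B $ i $ p i))"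
  proof (rule sum.reindex_bij_witness[where j = ?m and i = "map_permutation UNIV ?g"])
    fix p assume "p \<in> {p. p permutes {0..<?n}}"
    then have p: "p permutes {0..<?n}" by simp
    show "map_permutation UNIV ?g (?m p) = p"
      using inj by (intro map_permutation_compose_inv[OF f p]) auto
    show "?m p \<in> {p. p permutes UNIV}"
      using map_permutation_permutes[OF f p] by simp
    have "(\<Prod>i\<in>UNIV. B $ i $ ?m p i) = (\<Prod>i = 0..<?n. B $ ?f i $ ?m p (?f i))"
      by (rule prod.reindex_bij_betw[OF f, symmetric])
    also have "\<dots> = (\<Prod>i = 0..<?n. to_mat B $$ (i, p i))"
    proof (rule prod.cong[OF refl])
      fix i assume i: "i \<in> {0..<?n}"
      then have "p i \<in> {0..<?n}" using permutes_in_image[OF p] by blast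
      with i show "B $ ?f i $ ?m p (?f i) = to_mat B $$ (i, p i)"
        by (simp add: map_permutation_apply[OF inj i] to_mat_index)
    qed
    finally show "of_int (sign (?m p)) * (\<Prod>i\<in>UNIV. B $ i $ ?m p i) =
        signof p * (\<Prod>i = 0..<?n. to_mat B $$ (i, p i))"
      using sign_map_permutation[OF inj p] by simp
  next
    fix q assume "q \<in> {p. p permutes (UNIV :: 'n set)}"
    then have q: "q permutes UNIV" by simp
    show "?m (map_permutation UNIV ?g q) = q"
      using f by (intro map_permutation_compose_inv[OF g q]) (simp add: bij_betw_inv_into_right)
    show "map_permutation UNIV ?g q \<in> {p. p permutes {0..<?n}}"
      using map_permutation_permutes[OF g q] by simp
  qed
  also have "\<dots> = Determinants.det B" by (simp add: Determinants.det_def)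
  finally show ?thesis .
qed

lemma det_first_column:
  fixes B :: "'n::{finite,linorder} rmat"
  assumes "\<And>i. i \<noteq> coord 0 \<Longrightarrow> B $ i $ coord 0 = 0"
  shows "Determinants.det B = B $ coord 0 $ coord 0 * Determinant.det (mat_delete (to_mat B) 0 0)"
proof -
  have "Determinants.det B = (\<Sum>i<CARD('n). to_mat B $$ (i, 0) * cofactor (to_mat B) i 0)"
    unfolding det_to_mat[symmetric] by (rule laplace_expansion_column[OF to_mat_carrier]) simp
  also have "\<dots> = (\<Sum>i\<in>{0}. to_mat B $$ (i, 0) * cofactor (to_mat B) i 0)"
    using assms by (intro sum.mono_neutral_right) (auto simp: to_mat_index coord_eq_iff)
  finally show ?thesis by (simp add: to_mat_index cofactor_def)
qed

lemma det_first_row: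
  fixes B :: "'n::{finite,linorder} rmat"
  assumes "\<And>j. j \<noteq> coord 0 \<Longrightarrow> B $ coord 0 $ j = 0"
  shows "Determinants.det B = B $ coord 0 $ coord 0 * Determinant.det (mat_delete (to_mat B) 0 0)"
proof -
  have "Determinants.det B = (\<Sum>j<CARD('n). to_mat B $$ (0, j) * cofactor (to_mat B) 0 j)"
    unfolding det_to_mat[symmetric] by (rule laplace_expansion_row[OF to_mat_carrier]) simp
  also have "\<dots> = (\<Sum>j\<in>{0}. to_mat B $$ (0, j) * cofactor (to_mat B) 0 j)"
    using assms by (intro sum.mono_neutral_right) (auto simp: to_mat_index coord_eq_iff)
  finally show ?thesis by (simp add: to_mat_index cofactor_def)
qed

lemma mat_delete_to_mat_cong:
  fixes B C :: "'n::{finite,linorder} rmat"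
  assumes "\<And>i j. i \<noteq> coord 0 \<Longrightarrow> j \<noteq> coord 0 \<Longrightarrow> B $ i $ j = C $ i $ j"
  shows "mat_delete (to_mat B) 0 0 = mat_delete (to_mat C) 0 0"
  using assms by (intro eq_matI) (auto simp: mat_delete_def to_mat_def coord_eq_iff)

lemma M_block_carrier:
  "M_block (A :: 'n::{finite,linorder} rmat) c \<in> carrier_mat (CARD('n) - 1) (CARD('n) - 1)"
  unfolding M_block_def by (rule mat_delete_carrier[OF to_mat_carrier])

lemma M_matrix_mult_vec:
  "(M_matrix A c *v x) $ i = (A *v x) $ i - c $ i / c $ coord 0 * (A *v x) $ coord 0"
proof -
  have "M_matrix A c *v x =
      (Finite_Cartesian_Product.mat 1 - (1 / c $ coord 0) *\<^sub>R (\<chi> i j. c $ i * e1 $ j)) *v (A *v x)"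
    unfolding M_matrix_def by (simp add: matrix_vector_mul_assoc)
  also have "\<dots> $ i = (A *v x) $ i - c $ i / c $ coord 0 * (A *v x) $ coord 0"
    proof -
    have "(((1 / c $ coord 0) *\<^sub>R (\<chi> i j. c $ i * e1 $ j)) *v y) $ i = c $ i / c $ coord 0 * y $ coord 0"
      for y :: "'a rvec"
    proof -
      have "(((1 / c $ coord 0) *\<^sub>R (\<chi> i j. c $ i * e1 $ j)) *v y) $ i =
          (\<Sum>j\<in>UNIV. if j = coord 0 then c $ i / c $ coord 0 * y $ j else 0)"
        unfolding matrix_vector_mult_def vec_lambda_beta
        by (intro sum.cong) (simp_all add: e1_def axis_def)
      then show ?thesis by simp
    qed
    then show ?thesis by (simp add: matrix_vector_mult_diff_rdistrib)
  qed
  finally show ?thesis .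
qed

text \<open>A square matrix with the determinant of the block, available also for \<open>n = 1\<close>.\<close>

definition first_row_e1 :: "'n::{finite,linorder} rmat \<Rightarrow> 'n rmat" where
  "first_row_e1 B = (\<chi> i. if i = coord 0 then e1 else B $ i)"

lemma first_row_e1_mult_vec:
  "(first_row_e1 B *v x) $ i = (if i = coord 0 then x $ coord 0 else (B *v x) $ i)"
proof (cases "i = coord 0")
  case True
  have "(first_row_e1 B *v x) $ coord 0 = (\<Sum>j\<in>UNIV. if j = coord 0 then x $ j else 0)"
    unfolding matrix_vector_mult_def vec_lambda_beta
    by (intro sum.cong) (simp_all add: first_row_e1_def e1_def axis_def)
  then show ?thesis using True by simp
qed (simp add: first_row_e1_def matrix_vector_mult_def)

lemma det_first_row_e1:
  "Determinants.det (first_row_e1 B) = Determinant.det (mat_delete (to_mat B) 0 0)"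
proof -
  have "Determinants.det (first_row_e1 B) = first_row_e1 B $ coord 0 $ coord 0 *
      Determinant.det (mat_delete (to_mat (first_row_e1 B)) 0 0)"
    by (rule det_first_row) (simp add: first_row_e1_def e1_def axis_def)
  also have "mat_delete (to_mat (first_row_e1 B)) 0 0 = mat_delete (to_mat B) 0 0"
    by (rule mat_delete_to_mat_cong) (simp add: first_row_e1_def)
  finally show ?thesis by (simp add: first_row_e1_def e1_def axis_def)
qed

text \<open>Cramer's rule for \<open>A x = c\<close>, followed by the row operations that clear the column \<open>c\<close> of the
  numerator below its first entry; these operations are exactly \<open>I - c e\<^sub>1\<^sup>T / c\<^sub>1\<close> on the other rows.\<close>

lemma det_M_block:
  fixes A :: "'n::{finite,linorder} rmat" and c x :: "'n rvec"
  assumes c1: "c $ coord 0 \<noteq> 0" and x: "A *v x = c"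
  shows "x $ coord 0 * Determinants.det A = c $ coord 0 * Determinant.det (M_block A c)"
proof -
  let ?k = "coord 0 :: 'n"
  define B :: "'n rmat" where "B = (\<chi> i j. if j = ?k then c $ i else A $ i $ j)"
  define u :: "'n rvec" where "u = (\<chi> i. if i = ?k then 1 else - c $ i / c $ ?k)"
  \<comment> \<open>\<open>Q\<close> is the identity with first column \<open>u\<close>. Multiplying
    by it from the left subtracts \<open>c $ i / c $ ?k\<close> times the first row from every other
    row \<open>i\<close>.\<close>
  define Q :: "'n rmat" where
    "Q = (\<chi> i j. if j = ?k then u $ i else Finite_Cartesian_Product.mat 1 $ i $ j)"
  have detQ: "Determinants.det Q = 1"
    using cramer_lemma[of ?k "Finite_Cartesian_Product.mat 1" u] unfolding matrix_vector_mul_lid Q_def by (simp add: u_def)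
  have Q: "(Q ** C) $ i $ j = (if i = ?k then C $ ?k $ j else C $ i $ j - c $ i / c $ ?k * C $ ?k $ j)"
    for C :: "'n rmat" and i j
  proof -
    have "(Q ** C) $ i $ j = (\<Sum>l\<in>UNIV. (if l = ?k then u $ i * C $ ?k $ j else 0) +
        (if l = i then (if i = ?k then 0 else C $ i $ j) else 0))"
      unfolding matrix_matrix_mult_def vec_lambda_beta
      by (intro sum.cong) (auto simp: Q_def Finite_Cartesian_Product.mat_def)
    also have "\<dots> = u $ i * C $ ?k $ j + (if i = ?k then 0 else C $ i $ j)"
      unfolding sum.distrib by simp
    finally show ?thesis by (simp add: u_def)
  qed
  have M: "M_matrix A c $ i $ j = A $ i $ j - c $ i / c $ ?k * A $ ?k $ j" for i j
    using M_matrix_mult_vec[of A c "axis j 1" i]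
    by (simp add: matrix_vector_mult_basis column_def)
  have "x $ ?k * Determinants.det A = Determinants.det B"
    using cramer_lemma[of ?k A x] unfolding B_def x by simp
  also have "\<dots> = Determinants.det (Q ** B)" by (simp add: det_mul detQ)
  \<comment> \<open>The first column of \<open>B\<close> is \<open>c\<close>, so its entries below
    the first become \<open>c $ i - c $ i / c $ ?k * c $ ?k = 0\<close>.\<close>
  also have "\<dots> = (Q ** B) $ ?k $ ?k * Determinant.det (mat_delete (to_mat (Q ** B)) 0 0)"
    using c1 by (intro det_first_column) (simp add: Q B_def)
  also have "mat_delete (to_mat (Q ** B)) 0 0 = M_block A c"
    unfolding M_block_def by (rule mat_delete_to_mat_cong) (simp add: Q M B_def)
  also have "(Q ** B) $ ?k $ ?k = c $ ?k" by (simp add: Q B_def)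
  finally show ?thesis .
qed


section \<open>Landau estimates and first-order expansion of branches of zeros\<close>

lemma bigo_vec_iff:
  fixes f :: "'a \<Rightarrow> real ^ 'n"
  shows "(\<lambda>z. norm (f z)) \<in> O[F](g) \<longleftrightarrow> (\<forall>i. (\<lambda>z. f z $ i) \<in> O[F](g))"
proof safe
  fix i assume "(\<lambda>z. norm (f z)) \<in> O[F](g)"
  moreover have "(\<lambda>z. f z $ i) \<in> O[F](\<lambda>z. norm (f z))"
    by (intro landau_o.bigI[of 1] always_eventually) (auto simp: component_le_norm_cart)
  ultimately show "(\<lambda>z. f z $ i) \<in> O[F](g)" by (rule landau_o.big_trans[rotated])
next
  assume *: "\<forall>i. (\<lambda>z. f z $ i) \<in> O[F](g)"
  have "(\<lambda>z. norm (f z)) \<in> O[F](\<lambda>z. \<Sum>i\<in>UNIV. \<bar>f z $ i\<bar>)"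
    by (intro landau_o.bigI[of 1] always_eventually)
       (auto intro: order_trans[OF norm_le_l1_cart])
  also have "(\<lambda>z. \<Sum>i\<in>UNIV. \<bar>f z $ i\<bar>) \<in> O[F](g)"
    using * by (intro big_sum_in_bigo) simp
  finally show "(\<lambda>z. norm (f z)) \<in> O[F](g)" .
qed

text \<open>The filter \<open>nhds a\<close>, unlike \<open>at a\<close>, includes the point
  \<open>a\<close> itself, so the estimate can be evaluated there.\<close>

lemma bigo_nhds_zero:
  fixes f g :: "'a::topological_space \<Rightarrow> real"
  assumes "f \<in> O[nhds a](g)" and "g a = 0"
  shows "f a = 0"
proof -
  obtain C where "eventually (\<lambda>x. norm (f x) \<le> C * norm (g x)) (nhds a)"
    using landau_o.bigE[OF assms(1)] by blast
  from eventually_nhds_x_imp_x[OF this] assms(2) show ?thesis by simp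
qed

text \<open>The difference \<open>(q - p) * \<mu>\<close> is quadratically small; dividing by
  \<open>\<bar>\<mu>\<bar>\<close> and letting \<open>\<mu>\<close> tend to 0 leaves
  \<open>\<bar>q - p\<bar> \<le> 0\<close>. This identifies the given coefficients with computed
  ones.\<close>

lemma linear_coefficient_unique:
  fixes f :: "real \<Rightarrow> real"
  assumes "(\<lambda>\<mu>. f \<mu> - p * \<mu>) \<in> O[nhds 0](\<lambda>\<mu>. \<mu>\<^sup>2)" and "(\<lambda>\<mu>. f \<mu> - q * \<mu>) \<in> O[nhds 0](\<lambda>\<mu>. \<mu>\<^sup>2)"
  shows "p = q"
proof -
  have "(\<lambda>\<mu>. (f \<mu> - p * \<mu>) - (f \<mu> - q * \<mu>)) \<in> O[nhds 0](\<lambda>\<mu>. \<mu>\<^sup>2)"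
    by (rule sum_in_bigo[OF assms])
  then obtain C where ev: "eventually (\<lambda>\<mu>. norm ((f \<mu> - p * \<mu>) - (f \<mu> - q * \<mu>)) \<le> C * norm (\<mu>\<^sup>2)) (nhds 0)"
    by (rule landau_o.bigE)
  have "eventually (\<lambda>\<mu>. \<bar>q - p\<bar> \<le> C * \<bar>\<mu>\<bar>) (at (0::real))"
    unfolding eventually_at_filter using ev
  proof eventually_elim
    case (elim \<mu>)
    have "\<bar>q - p\<bar> * \<bar>\<mu>\<bar> = \<bar>(f \<mu> - p * \<mu>) - (f \<mu> - q * \<mu>)\<bar>"
      by (simp add: algebra_simps flip: abs_mult)
    also have "\<dots> \<le> (C * \<bar>\<mu>\<bar>) * \<bar>\<mu>\<bar>"
      using elim by (simp add: power2_eq_square abs_mult)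
    finally show ?case by (blast intro: mult_right_le_imp_le zero_less_abs_iff[THEN iffD2])
  qed
  moreover have "((\<lambda>\<mu>. C * \<bar>\<mu>\<bar>) \<longlongrightarrow> C * \<bar>0\<bar>) (at (0::real))" by (intro tendsto_intros)
  ultimately have "\<bar>q - p\<bar> \<le> C * \<bar>0\<bar>" by (intro tendsto_lowerbound) auto
  then show ?thesis by simp
qed

text \<open>The error splits as \<open>(f - l) g + l (g - c)\<close>: a quadratic term times a
  bounded one, plus a product of two terms of first order.\<close>

lemma bigo_mult_linearization:
  fixes f g l s :: "'a \<Rightarrow> real"
  assumes f: "(\<lambda>z. f z - l z) \<in> O[F](\<lambda>z. (s z)\<^sup>2)" and l: "l \<in> O[F](s)"
    and g: "(\<lambda>z. g z - c) \<in> O[F](s)" and s: "s \<in> O[F](\<lambda>_. 1)"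
  shows "(\<lambda>z. f z * g z - l z * c) \<in> O[F](\<lambda>z. (s z)\<^sup>2)"
proof -
  have "(\<lambda>z. (g z - c) + c) \<in> O[F](\<lambda>_. 1)"
    by (rule sum_in_bigo(1)[OF landau_o.big_trans[OF g s]]) simp
  then have "(\<lambda>z. (f z - l z) * g z) \<in> O[F](\<lambda>z. (s z)\<^sup>2 * 1)"
    by (intro landau_o.big.mult f) simp
  moreover have "(\<lambda>z. l z * (g z - c)) \<in> O[F](\<lambda>z. s z * s z)"
    by (intro landau_o.big.mult l g)
  ultimately have "(\<lambda>z. (f z - l z) * g z + l z * (g z - c)) \<in> O[F](\<lambda>z. (s z)\<^sup>2)"
    by (intro sum_in_bigo) (simp_all add: power2_eq_square)
  then show ?thesis by (simp add: algebra_simps)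
qed

text \<open>Brouwer's theorem for \<open>x - B\<^sup>-\<^sup>1 F(x, \<mu>)\<close> on the ball of radius \<open>K \<bar>\<mu>\<bar>\<close>.\<close>

lemma zero_of_linear_perturbation:
  fixes F :: "(real ^ 'n) \<times> real \<Rightarrow> real ^ 'n" and B :: "real ^ 'n ^ 'n"
  assumes U: "open U" "(0, 0) \<in> U" "continuous_on U F"
    and det: "Determinants.det B \<noteq> 0"
    and bigo: "(\<lambda>z. norm (F z - (B *v fst z + snd z *\<^sub>R b))) \<in> O[nhds (0, 0)](\<lambda>z. (norm z)\<^sup>2)"
  obtains K where "eventually (\<lambda>\<mu>. \<exists>x. norm x \<le> K * \<bar>\<mu>\<bar> \<and> F (x, \<mu>) = 0) (nhds 0)"
proof -
  obtain B' where B': "B ** B' = Finite_Cartesian_Product.mat 1" "B' ** B = Finite_Cartesian_Product.mat 1"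
    using det unfolding invertible_det_nz[symmetric] invertible_def by blast
  obtain L where L: "L > 0" "\<And>y. norm (B' *v y) \<le> L * norm y"
    using linear_bounded_pos[OF matrix_vector_mul_linear, of B'] by blast
  obtain C where C: "C > 0"
    "eventually (\<lambda>z. norm (F z - (B *v fst z + snd z *\<^sub>R b)) \<le> C * (norm z)\<^sup>2) (nhds (0, 0))"
    using landau_o.bigE[OF bigo] by auto
  have "eventually (\<lambda>z. z \<in> U) (nhds (0, 0))" using U eventually_nhds_in_open by blast
  from eventually_conj[OF C(2) this] obtain e where e: "e > 0" "\<And>z. dist z (0, 0) < e \<Longrightarrow>
      norm (F z - (B *v fst z + snd z *\<^sub>R b)) \<le> C * (norm z)\<^sup>2 \<and> z \<in> U"
    unfolding eventually_nhds_metric by auto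
  \<comment> \<open>With remainder at most \<open>\<bar>\<mu>\<bar>\<close>, this bounds the image
    under \<open>B'\<close> of \<open>\<mu> *\<^sub>R b\<close> plus the remainder by
    \<open>K * \<bar>\<mu>\<bar>\<close>.\<close>
  define K where "K = L * (norm b + 1)"
  have K: "K > 0" using L by (simp add: K_def add_nonneg_pos)
  \<comment> \<open>The first bound keeps \<open>(x, \<mu>)\<close> in the \<open>e\<close>-ball
    whenever \<open>norm x \<le> K * \<bar>\<mu>\<bar>\<close>; the second makes the quadratic
    remainder at most \<open>\<bar>\<mu>\<bar>\<close>.\<close>
  define d where "d = min (e / (K + 1)) (1 / (C * (K + 1)\<^sup>2))"
  have d: "d > 0" using e C K by (simp add: d_def)
  have "\<exists>x. norm x \<le> K * \<bar>\<mu>\<bar> \<and> F (x, \<mu>) = 0" if mu: "\<bar>\<mu>\<bar> < d" for \<mu>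
  proof -
    define T where "T x = x - B' *v F (x, \<mu>)" for x
    have near: "(x, \<mu>) \<in> U \<and> norm (F (x, \<mu>) - (B *v x + \<mu> *\<^sub>R b)) \<le> \<bar>\<mu>\<bar>"
      if "norm x \<le> K * \<bar>\<mu>\<bar>" for x
    proof -
      have nz: "norm (x, \<mu>) \<le> (K + 1) * \<bar>\<mu>\<bar>"
        using norm_Pair_le[of x \<mu>] that by (simp add: algebra_simps)
      also have "\<dots> < e" using mu K by (simp add: d_def pos_less_divide_eq mult.commute)
      finally have "dist (x, \<mu>) (0, 0) < e" by (simp add: dist_norm)
      from e(2)[OF this] have *: "(x, \<mu>) \<in> U"
        "norm (F (x, \<mu>) - (B *v x + \<mu> *\<^sub>R b)) \<le> C * (norm (x, \<mu>))\<^sup>2" by auto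
      have "C * (norm (x, \<mu>))\<^sup>2 \<le> C * ((K + 1) * \<bar>\<mu>\<bar>)\<^sup>2"
        using nz C by (intro mult_left_mono power_mono) auto
      also have "\<dots> = (C * (K + 1)\<^sup>2 * \<bar>\<mu>\<bar>) * \<bar>\<mu>\<bar>" by (simp add: power2_eq_square)
      also have "\<dots> \<le> 1 * \<bar>\<mu>\<bar>"
      proof (rule mult_right_mono)
        have "\<bar>\<mu>\<bar> < 1 / (C * (K + 1)\<^sup>2)" using mu by (simp add: d_def)
        moreover have "C * (K + 1)\<^sup>2 > 0" using C K by simp
        ultimately show "C * (K + 1)\<^sup>2 * \<bar>\<mu>\<bar> \<le> 1"
          by (simp add: pos_less_divide_eq mult.commute)
      qed simp
      finally show ?thesis using * by simp
    qed
    have maps: "norm (T x) \<le> K * \<bar>\<mu>\<bar>" if "norm x \<le> K * \<bar>\<mu>\<bar>" for x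
    proof -
      let ?R = "F (x, \<mu>) - (B *v x + \<mu> *\<^sub>R b)"
      have "B' *v (\<mu> *\<^sub>R b + ?R) = B' *v F (x, \<mu>) - (B' ** B) *v x"
        by (simp add: matrix_vector_mult_diff_distrib flip: matrix_vector_mul_assoc)
      then have "T x = - (B' *v (\<mu> *\<^sub>R b + ?R))" by (simp add: T_def B')
      then have "norm (T x) \<le> L * norm (\<mu> *\<^sub>R b + ?R)" using L(2) by simp
      also have "\<dots> \<le> L * (\<bar>\<mu>\<bar> * norm b + \<bar>\<mu>\<bar>)"
        using L(1) near[OF that] norm_triangle_ineq[of "\<mu> *\<^sub>R b" ?R] by (intro mult_left_mono) auto
      finally show ?thesis by (simp add: K_def algebra_simps)
    qed
    have "\<exists>x. norm x \<le> K * \<bar>\<mu>\<bar> \<and> T x = x"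
    \<comment> \<open>For \<open>\<mu> = 0\<close> the ball degenerates to a point and
      \<open>maps\<close> gives \<open>T 0 = 0\<close>; Brouwer's theorem needs a positive
      radius.\<close>
    proof (cases "\<mu> = 0")
      case True
      then show ?thesis using maps[of 0] by auto
    next
      case False
      have "continuous_on (cball 0 (K * \<bar>\<mu>\<bar>)) (\<lambda>x. F (x, \<mu>))"
        by (rule continuous_on_compose2[OF U(3)]) (use near in \<open>auto intro!: continuous_intros\<close>)
      from linear_continuous_on_compose[OF this matrix_vector_mul_linear]
      have cont: "continuous_on (cball 0 (K * \<bar>\<mu>\<bar>)) T"
        unfolding T_def by (rule continuous_on_diff[OF continuous_on_id])
      have "K * \<bar>\<mu>\<bar> > 0" using K False by simp
      moreover have "T \<in> cball 0 (K * \<bar>\<mu>\<bar>) \<rightarrow> cball 0 (K * \<bar>\<mu>\<bar>)" using maps by simp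
      ultimately obtain x where "x \<in> cball 0 (K * \<bar>\<mu>\<bar>)" "T x = x"
        by (rule brouwer_ball[OF _ cont])
      then show ?thesis by auto
    qed
    then obtain x where x: "norm x \<le> K * \<bar>\<mu>\<bar>" "B' *v F (x, \<mu>) = 0" by (auto simp: T_def)
    have "F (x, \<mu>) = B *v (B' *v F (x, \<mu>))" by (simp add: matrix_vector_mul_assoc B')
    with x show ?thesis by auto
  qed
  with d show ?thesis by (intro that[of K]) (auto simp: eventually_nhds_metric)
qed

text \<open>Some zero of \<open>F\<close> has norm at most \<open>K * \<bar>\<mu>\<bar>\<close>, and
  local uniqueness identifies it with \<open>X \<mu>\<close>. On this scale the remainder is
  \<open>O(\<mu>\<^sup>2)\<close>, and applying the inverse of \<open>B\<close> to it yields
  \<open>X \<mu> - \<mu> *\<^sub>R v\<close>.\<close>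

lemma branch_linearization:
  fixes F :: "(real ^ 'n) \<times> real \<Rightarrow> real ^ 'n" and B :: "real ^ 'n ^ 'n"
  assumes U: "open U" "(0, 0) \<in> U" "continuous_on U F"
    and det: "Determinants.det B \<noteq> 0"
    and bigo: "(\<lambda>z. norm (F z - (B *v fst z + snd z *\<^sub>R b))) \<in> O[nhds (0, 0)](\<lambda>z. (norm z)\<^sup>2)"
    and zero: "eventually (\<lambda>z. F z = 0 \<longrightarrow> P (fst z) (snd z)) (nhds (0, 0))"
    and branch: "unique_local_branch P X"
    and v: "B *v v = - b"
  shows "(\<lambda>\<mu>. norm (X \<mu> - \<mu> *\<^sub>R v)) \<in> O[nhds 0](\<lambda>\<mu>. \<mu>\<^sup>2)"
proof -
  obtain K where K: "eventually (\<lambda>\<mu>. \<exists>x. norm x \<le> K * \<bar>\<mu>\<bar> \<and> F (x, \<mu>) = 0) (nhds 0)"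
    using zero_of_linear_perturbation[OF U det bigo] .
  obtain C where C: "C > 0"
    "eventually (\<lambda>z. norm (F z - (B *v fst z + snd z *\<^sub>R b)) \<le> C * (norm z)\<^sup>2) (nhds (0, 0))"
    using landau_o.bigE[OF bigo] by auto
  obtain B' where B': "B' ** B = Finite_Cartesian_Product.mat 1"
    using det unfolding invertible_det_nz[symmetric] invertible_def by blast
  obtain L where L: "L > 0" "\<And>y. norm (B' *v y) \<le> L * norm y"
    using linear_bounded_pos[OF matrix_vector_mul_linear, of B'] by blast
  obtain V W where VW: "open V" "0 \<in> V" "open W" "0 \<in> W"
    "\<And>\<mu> x. \<mu> \<in> W \<Longrightarrow> x \<in> V \<Longrightarrow> P x \<mu> \<Longrightarrow> x = X \<mu>"
    using branch unfolding unique_local_branch_def by blast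
  have "eventually (\<lambda>z. z \<in> V \<times> W) (nhds (0, 0))"
    using VW by (intro eventually_nhds_in_open open_Times) auto
  from eventually_conj[OF eventually_conj[OF C(2) zero] this]
  obtain e where e: "e > 0" "\<And>z. dist z (0, 0) < e \<Longrightarrow>
     norm (F z - (B *v fst z + snd z *\<^sub>R b)) \<le> C * (norm z)\<^sup>2 \<and>
     (F z = 0 \<longrightarrow> P (fst z) (snd z)) \<and> z \<in> V \<times> W"
    unfolding eventually_nhds_metric by auto
  have "((\<lambda>\<mu>. (K + 1) * \<bar>\<mu>\<bar>) \<longlongrightarrow> (K + 1) * \<bar>0\<bar>) (nhds (0::real))" by (intro tendsto_intros filterlim_ident)
  then have "eventually (\<lambda>\<mu>. (K + 1) * \<bar>\<mu>\<bar> < e) (nhds (0::real))"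
    using e(1) by (intro order_tendstoD) auto
  with K have "eventually (\<lambda>\<mu>. norm (X \<mu> - \<mu> *\<^sub>R v) \<le> L * C * (K + 1)\<^sup>2 * \<mu>\<^sup>2) (nhds 0)"
  proof eventually_elim
    case (elim \<mu>)
    then obtain x where x: "norm x \<le> K * \<bar>\<mu>\<bar>" "F (x, \<mu>) = 0" by blast
    have nz: "norm (x, \<mu>) \<le> (K + 1) * \<bar>\<mu>\<bar>"
      using norm_Pair_le[of x \<mu>] x by (simp add: algebra_simps)
    with elim(2) have "dist (x, \<mu>) (0, 0) < e" by (simp add: dist_norm)
    from e(2)[OF this] x have "norm (0 - (B *v x + \<mu> *\<^sub>R b)) \<le> C * (norm (x, \<mu>))\<^sup>2"
      and "P x \<mu>" "x \<in> V" "\<mu> \<in> W" by auto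
    then have *: "norm (B *v x + \<mu> *\<^sub>R b) \<le> C * (norm (x, \<mu>))\<^sup>2" "x = X \<mu>"
      using VW(5) by (simp_all only: norm_minus_commute[of 0] diff_0_right)
    have "B *v x + \<mu> *\<^sub>R b = B *v (x - \<mu> *\<^sub>R v)"
      by (simp add: v matrix_vector_mult_diff_distrib matrix_vector_mult_scaleR)
    then have "B' *v (B *v x + \<mu> *\<^sub>R b) = x - \<mu> *\<^sub>R v"
      by (simp add: matrix_vector_mul_assoc B')
    then have "norm (X \<mu> - \<mu> *\<^sub>R v) \<le> L * norm (B *v x + \<mu> *\<^sub>R b)"
      using L(2)[of "B *v x + \<mu> *\<^sub>R b"] by (simp add: *(2))
    also have "\<dots> \<le> L * (C * ((K + 1) * \<bar>\<mu>\<bar>)\<^sup>2)"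
      using L(1) C(1) nz by (intro mult_left_mono order_trans[OF *(1)] power_mono) auto
    finally show ?case by (simp add: power_mult_distrib mult_ac)
  qed
  \<comment> \<open>The sign of \<open>K\<close> is not recorded here, so the constant could be 0;
    the maximum with 1 makes it positive.\<close>
  then show ?thesis by (intro landau_o.bigI[of "max 1 (L * C * (K + 1)\<^sup>2)"])
     (auto elim!: eventually_mono intro: order_trans[OF _ mult_right_mono])
qed


section \<open>Pseudo-equilibria as zeros of a field with invertible linear part\<close>

lemma C2_on_imp_continuous_on: "C2_on U F \<Longrightarrow> continuous_on U F"
  unfolding C2_on_def
  by (meson continuous_at_imp_continuous_on has_derivative_continuous)

text \<open>The first component of \<open>F\<^sup>L\<^sub>1 F\<^sup>R - F\<^sup>R\<^sub>1 F\<^sup>L\<close> vanishes identically; putting \<open>x\<^sub>1\<close> in its place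
  encodes the constraint \<open>x \<in> \<Sigma>\<close> and makes the linearization invertible.\<close>

definition sliding_zero_field ::
  "'n::{finite,linorder} field_family \<Rightarrow> 'n field_family \<Rightarrow> real \<Rightarrow> 'n field_family" where
  "sliding_zero_field FL FR c1 z =
     (\<chi> i. if i = coord 0 then fst z $ coord 0
          else - (FL z $ coord 0 * FR z $ i - FR z $ coord 0 * FL z $ i) / c1)"

lemma sliding_zero_field_imp_pseudo_equilibrium:
  assumes "sliding_zero_field FL FR c1 z = 0" and "c1 \<noteq> 0" and "FL z $ coord 0 \<noteq> FR z $ coord 0"
  shows "pseudo_equilibrium FL FR (fst z) (snd z)"
proof -
  have *: "(if i = coord 0 then fst z $ coord 0
          else - (FL z $ coord 0 * FR z $ i - FR z $ coord 0 * FL z $ i) / c1) = 0" for i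
  proof -
    have "sliding_zero_field FL FR c1 z $ i = 0" using assms(1) by simp
    then show ?thesis unfolding sliding_zero_field_def vec_lambda_beta .
  qed
  have "FL z $ coord 0 * FR z $ i - FR z $ coord 0 * FL z $ i = 0" for i
    using *[of i] assms(2) by (cases "i = coord 0") auto
  then have "sliding_field FL FR z = 0" by (simp add: sliding_field_def Finite_Cartesian_Product.vec_eq_iff)
  with *[of "coord 0"] assms(3) show ?thesis by (simp add: pseudo_equilibrium_def)
qed

text \<open>With \<open>l = A x + \<mu> b\<close>, each product \<open>FL_j FR_m\<close> is
  \<open>l_j c_m + O(2)\<close>. Dividing \<open>l_1 c_i - c_1 l_i\<close> by \<open>- c_1\<close>
  gives \<open>l_i - (c_i / c_1) l_1\<close>, which is component \<open>i\<close> of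
  \<open>M x + \<mu> b'\<close>.\<close>

lemma sliding_zero_field_linearization:
  fixes FL FR :: "'n::{finite,linorder} field_family" and A :: "'n rmat" and b c :: "'n rvec"
  assumes FL: "(\<lambda>z. norm (FL z - (A *v fst z + snd z *\<^sub>R b))) \<in> O[nhds (0, 0)](\<lambda>z. (norm z)\<^sup>2)"
    and FR: "(\<lambda>z. norm (FR z - c)) \<in> O[nhds (0, 0)](\<lambda>z. norm z)"
    and c1: "c $ coord 0 \<noteq> 0"
  defines "b' \<equiv> \<chi> i. b $ i - c $ i / c $ coord 0 * b $ coord 0"
  shows "(\<lambda>z. norm (sliding_zero_field FL FR (c $ coord 0) z -
      (first_row_e1 (M_matrix A c) *v fst z + snd z *\<^sub>R b'))) \<in> O[nhds (0, 0)](\<lambda>z. (norm z)\<^sup>2)"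
  unfolding bigo_vec_iff
proof
  fix i :: 'n
  let ?k = "coord 0 :: 'n"
  let ?l = "\<lambda>z. A *v fst z + snd z *\<^sub>R b"
  have FL': "(\<lambda>z. FL z $ j - ?l z $ j) \<in> O[nhds (0, 0)](\<lambda>z. (norm z)\<^sup>2)" for j
    using FL unfolding bigo_vec_iff by simp
  have FR': "(\<lambda>z. FR z $ j - c $ j) \<in> O[nhds (0, 0)](\<lambda>z. norm z)" for j
    using FR unfolding bigo_vec_iff by simp
  have l: "(\<lambda>z. ?l z $ j) \<in> O[nhds (0, 0)](\<lambda>z. norm z)" for j
  proof -
    have "linear (\<lambda>z. ?l z $ j)"
      by (rule linearI) (simp_all add: matrix_vector_right_distrib algebra_simps matrix_vector_mult_scaleR)
    then obtain K where "\<And>z. norm (?l z $ j) \<le> K * norm z" using linear_bounded by blast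
    then show ?thesis by (intro bigoI[of _ K]) simp
  qed
  have bounded: "(\<lambda>z. norm z) \<in> O[nhds (0 :: 'n rvec, 0 :: real)](\<lambda>_. 1)"
    by (rule bigoI_tendsto[of _ _ 0]) (auto intro!: tendsto_eq_intros filterlim_ident simp: zero_prod_def)
  have prod: "(\<lambda>z. FL z $ j * FR z $ m - ?l z $ j * c $ m) \<in> O[nhds (0, 0)](\<lambda>z. (norm z)\<^sup>2)" for j m
    by (rule bigo_mult_linearization[OF FL' l FR' bounded])
  show "(\<lambda>z. (sliding_zero_field FL FR (c $ coord 0) z -
      (first_row_e1 (M_matrix A c) *v fst z + snd z *\<^sub>R b')) $ i) \<in> O[nhds (0, 0)](\<lambda>z. (norm z)\<^sup>2)"
  proof (cases "i = ?k")
    \<comment> \<open>The error vanishes identically here: both sides have first component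
      \<open>x_1\<close>, because the first component of \<open>b'\<close> is 0.\<close>
    case True
    then show ?thesis
      using c1 by (simp add: sliding_zero_field_def first_row_e1_mult_vec b'_def)
  next
    case False
    have "(sliding_zero_field FL FR (c $ coord 0) z -
      (first_row_e1 (M_matrix A c) *v fst z + snd z *\<^sub>R b')) $ i =
      - 1 / c $ ?k * ((FL z $ ?k * FR z $ i - ?l z $ ?k * c $ i) - (FL z $ i * FR z $ ?k - ?l z $ i * c $ ?k))" for z
      using c1 False
      by (simp add: sliding_zero_field_def first_row_e1_mult_vec M_matrix_mult_vec b'_def field_simps)
    moreover have "(\<lambda>z. - 1 / c $ ?k * ((FL z $ ?k * FR z $ i - ?l z $ ?k * c $ i) - (FL z $ i * FR z $ ?k - ?l z $ i * c $ ?k)))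
       \<in> O[nhds (0, 0)](\<lambda>z. (norm z)\<^sup>2)"
      by (subst landau_o.big.cmult_in_iff) (use c1 in simp, rule sum_in_bigo(2)[OF prod prod])
    ultimately show ?thesis by simp
  qed
qed

lemma continuous_on_sliding_zero_field:
  assumes "continuous_on U FL" and "continuous_on U FR"
  shows "continuous_on U (sliding_zero_field FL FR c1)"
  unfolding sliding_zero_field_def
proof (intro continuous_intros)
  fix i
  show "continuous_on U (\<lambda>z. if i = coord 0 then fst z $ coord 0
      else - (FL z $ coord 0 * FR z $ i - FR z $ coord 0 * FL z $ i) / c1)"
    using assms by (cases "i = coord 0") (auto intro!: continuous_intros simp: divide_inverse)
qed

section \<open>Linear algebra of the two coefficients\<close>

lemma sgn_branch_coefficients:
  fixes A :: "'n::{finite,linorder} rmat" and b c vL vS :: "'n rvec"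
  defines "k \<equiv> coord 0 :: 'n"
  assumes detA: "Determinants.det A \<noteq> 0" and detM: "Determinant.det (M_block A c) \<noteq> 0"
    and c1: "c $ k \<noteq> 0"
    and vL: "A *v vL = - b" and nz: "vL $ k \<noteq> 0"
    and vS: "first_row_e1 (M_matrix A c) *v vS = - (\<chi> i. b $ i - c $ i / c $ k * b $ k)"
  shows "sgn (vL $ k * (c $ k * (A *v vS + b) $ k)) =
     (-1) ^ (num_pos_eigenvalues (to_mat A) + num_pos_eigenvalues (M_block A c)) * sgn (c $ k)"
proof -
  obtain y where y: "A *v y = c"
    using detA cramer by blast
  \<comment> \<open>The first component fixes the factor \<open>t\<close>; the remaining rows of the
    equation for \<open>vS\<close> then say exactly that \<open>A *v vS + b\<close> is
    \<open>t\<close> times \<open>c\<close>.\<close>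
  define t where "t = (A *v vS + b) $ k / c $ k"
  have comp: "(first_row_e1 (M_matrix A c) *v vS) $ i = - (b $ i - c $ i / c $ k * b $ k)" for i
    using vS by (simp add: Finite_Cartesian_Product.vec_eq_iff)
  have vS_k: "vS $ k = 0"
    using comp[of k] c1 by (simp add: first_row_e1_mult_vec k_def)
  have "A *v vS + b = t *\<^sub>R c"
  unfolding Finite_Cartesian_Product.vec_eq_iff
  proof
    fix i
    show "(A *v vS + b) $ i = (t *\<^sub>R c) $ i"
    proof (cases "i = k")
      case True
      then show ?thesis using c1 by (simp add: t_def)
    next
      case False
      then show ?thesis using comp[of i] c1
        by (simp add: first_row_e1_mult_vec M_matrix_mult_vec t_def k_def field_simps)
    qed
  qed
  then have "A *v vS = A *v (vL + t *\<^sub>R y)"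
    by (simp add: matrix_vector_right_distrib matrix_vector_mult_scaleR vL y algebra_simps)
  \<comment> \<open>Injectivity of \<open>A\<close>: both vectors equal the same Cramer
    quotient.\<close>
  from trans[OF iffD1[OF cramer[OF detA] this] iffD1[OF cramer[OF detA] refl, symmetric]]
  have "vS = vL + t *\<^sub>R y"
    .
  then have vL_k: "vL $ k = - t * y $ k" using vS_k by simp
  with nz have t: "t \<noteq> 0" by auto
  let ?dA = "Determinants.det A" and ?dM = "Determinant.det (M_block A c)"
  let ?p = "vL $ k * (c $ k * (A *v vS + b) $ k)"
  have key: "y $ k * ?dA = c $ k * ?dM" using det_M_block[OF _ y] c1 by (simp add: k_def)
  \<comment> \<open>Multiplying by \<open>?dA\<close> replaces \<open>y $ k\<close>, known only
    through \<open>key\<close>, by \<open>?dM\<close>; everything else is a square or a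
    sign.\<close>
  have "?p * ?dA = - (t\<^sup>2 * (c $ k)\<^sup>2 * (y $ k * ?dA))"
    using c1 by (simp add: vL_k t_def power2_eq_square)
  also have "\<dots> = - (t\<^sup>2 * (c $ k)\<^sup>2 * (c $ k * ?dM))" by (simp only: key)
  finally have "sgn (?p * ?dA) = - (sgn (t\<^sup>2 * (c $ k)\<^sup>2) * (sgn (c $ k) * sgn ?dM))"
    by (simp add: sgn_mult)
  moreover have "sgn (t\<^sup>2 * (c $ k)\<^sup>2) = 1" using t c1 by simp
  ultimately have "sgn ?p * sgn ?dA = - (sgn (c $ k) * sgn ?dM)"
    by (simp only: sgn_mult mult_1)
  moreover have "sgn ?dA = (-1) ^ (CARD('n) + num_pos_eigenvalues (to_mat A))"
    using sgn_det_eq_num_pos_eigenvalues[OF to_mat_carrier, of A] detA by (simp add: det_to_mat)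
  moreover have "sgn ?dM = (-1) ^ (CARD('n) - 1 + num_pos_eigenvalues (M_block A c))"
    using sgn_det_eq_num_pos_eigenvalues[OF M_block_carrier detM] .
  \<comment> \<open>The block is one row smaller than \<open>A\<close>, so the two sizes add up to
    an odd number, whose sign cancels the minus sign above.\<close>
  moreover obtain m where "CARD('n) = Suc m"
    using zero_less_card_finite[where ?'a = 'n] gr0_conv_Suc by blast
  ultimately show ?thesis
    by (cases "even m"; cases "even (num_pos_eigenvalues (to_mat A))") (simp_all add: power_add, metis minus_equation_iff mult.commute)
qed


section \<open>Expansions along the branches and conclusion\<close>

text \<open>The two facts for pulling an estimate at the origin back along a branch: the limit
  permits composition, and the bound turns powers of \<open>norm z\<close> into powers of
  \<open>\<mu>\<close>.\<close>

lemma bigo_branch_point: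
  fixes X :: "real \<Rightarrow> real ^ 'n"
  assumes "(\<lambda>\<mu>. norm (X \<mu> - \<mu> *\<^sub>R v)) \<in> O[nhds 0](\<lambda>\<mu>. \<mu>\<^sup>2)"
  shows "(\<lambda>\<mu>. norm (X \<mu>, \<mu>)) \<in> O[nhds 0](\<lambda>\<mu>. \<mu>)"
    and "filterlim (\<lambda>\<mu>. (X \<mu>, \<mu>)) (nhds (0, 0)) (nhds 0)"
proof -
  have sq: "(\<lambda>\<mu>::real. \<mu>\<^sup>2) \<in> O[nhds 0](\<lambda>\<mu>. \<mu>)"
  proof -
    have "(\<lambda>\<mu>::real. \<mu>) \<in> O[nhds 0](\<lambda>_. 1)"
      by (rule bigoI_tendsto[of _ _ 0]) (auto intro!: filterlim_ident)
    from landau_o.big.mult[OF this landau_o.big_refl] show ?thesis by (simp add: power2_eq_square)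
  qed
  have "(\<lambda>\<mu>. norm (X \<mu> - \<mu> *\<^sub>R v) + ((norm v + 1) * \<bar>\<mu>\<bar>)) \<in> O[nhds 0](\<lambda>\<mu>. \<mu>)"
    by (rule sum_in_bigo(1)[OF landau_o.big_trans[OF assms sq]]) simp
  moreover have "(\<lambda>\<mu>. norm (X \<mu>, \<mu>)) \<in> O[nhds 0](\<lambda>\<mu>. norm (X \<mu> - \<mu> *\<^sub>R v) + ((norm v + 1) * \<bar>\<mu>\<bar>))"
  proof (intro landau_o.bigI[of 1] always_eventually allI)
    fix \<mu>
    have "norm (X \<mu>, \<mu>) \<le> norm (X \<mu>) + \<bar>\<mu>\<bar>" using norm_Pair_le[of "X \<mu>" \<mu>] by simp
    also have "norm (X \<mu>) \<le> norm (X \<mu> - \<mu> *\<^sub>R v) + norm (\<mu> *\<^sub>R v)"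
      by (metis diff_add_cancel norm_triangle_ineq)
    finally show "norm (norm (X \<mu>, \<mu>)) \<le> 1 * norm (norm (X \<mu> - \<mu> *\<^sub>R v) + ((norm v + 1) * \<bar>\<mu>\<bar>))"
      by (simp add: algebra_simps)
  qed simp
  ultimately show *: "(\<lambda>\<mu>. norm (X \<mu>, \<mu>)) \<in> O[nhds 0](\<lambda>\<mu>. \<mu>)"
    by (rule landau_o.big_trans[rotated])
  obtain C where "eventually (\<lambda>\<mu>. norm (X \<mu>, \<mu>) \<le> C * \<bar>\<mu>\<bar>) (nhds 0)"
    using landau_o.bigE[OF *] by auto
  moreover have "((\<lambda>\<mu>. C * \<bar>\<mu>\<bar>) \<longlongrightarrow> 0) (nhds 0)"
    by (auto intro!: tendsto_eq_intros filterlim_ident)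
  ultimately have "((\<lambda>\<mu>. (X \<mu>, \<mu>)) \<longlongrightarrow> 0) (nhds 0)" by (rule Lim_null_comparison)
  then show "filterlim (\<lambda>\<mu>. (X \<mu>, \<mu>)) (nhds (0, 0)) (nhds 0)" by (simp add: zero_prod_def)
qed

theorem theorem4:
  fixes FL FR :: "'n::{finite,linorder} rvec \<times> real \<Rightarrow> 'n rvec"
    and U :: "('n rvec \<times> real) set"
    and A :: "'n rmat"
    and b c :: "'n rvec"
    and xL xS :: "real \<Rightarrow> 'n rvec"
    and \<alpha>L \<alpha>S :: real
  assumes "open U" and "(0, 0) \<in> U"
    and "C2_on U FL" and "C2_on U FR"
    and "(\<lambda>(x, \<mu>). norm (FL (x, \<mu>) - (A *v x + \<mu> *\<^sub>R b))) \<in> O[nhds (0, 0)](\<lambda>z. (norm z)\<^sup>2)"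
    and "(\<lambda>(x, \<mu>). norm (FR (x, \<mu>) - c)) \<in> O[nhds (0, 0)](\<lambda>z. norm z)"
    and "Determinants.det A \<noteq> 0"
    and "Determinant.det (M_block A c) \<noteq> 0"
    and "c $ coord 0 \<noteq> 0"
    and "unique_local_branch (regular_equilibrium FL FR) xL"
    and "unique_local_branch (pseudo_equilibrium FL FR) xS"
    and "(\<lambda>\<mu>. xL \<mu> $ coord 0 - \<alpha>L * \<mu>) \<in> O[nhds 0](\<lambda>\<mu>. \<mu>\<^sup>2)"
    and "(\<lambda>\<mu>. chi FL FR (xS \<mu>, \<mu>) - \<alpha>S * \<mu>) \<in> O[nhds 0](\<lambda>\<mu>. \<mu>\<^sup>2)"
    and "\<alpha>L \<noteq> 0"
  shows "sgn (\<alpha>L * \<alpha>S) =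
     (-1) ^ (num_pos_eigenvalues (to_mat A) + num_pos_eigenvalues (M_block A c))
       * sgn (c $ coord 0)"
proof -
  let ?k = "coord 0 :: 'n"
  define b' :: "'n rvec" where "b' = (\<chi> i. b $ i - c $ i / c $ ?k * b $ ?k)"
  let ?N = "first_row_e1 (M_matrix A c)"
  let ?H = "sliding_zero_field FL FR (c $ ?k)"
  have FL: "(\<lambda>z. norm (FL z - (A *v fst z + snd z *\<^sub>R b))) \<in> O[nhds (0, 0)](\<lambda>z. (norm z)\<^sup>2)"
    using assms(5) by (simp add: case_prod_unfold)
  have FR: "(\<lambda>z. norm (FR z - c)) \<in> O[nhds (0, 0)](\<lambda>z. norm z)"
    using assms(6) by (simp add: case_prod_unfold)
  have contL: "continuous_on U FL" and contR: "continuous_on U FR"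
    using assms(3,4) by (auto intro: C2_on_imp_continuous_on)
  have FL0: "FL (0, 0) = 0" using bigo_nhds_zero[OF FL] by (simp add: zero_prod_def[symmetric])
  have FR0: "FR (0, 0) = c" using bigo_nhds_zero[OF FR] by (simp add: zero_prod_def[symmetric])
  have detN: "Determinants.det ?N \<noteq> 0"
    using assms(8) unfolding det_first_row_e1 M_block_def .
  obtain vL where vL: "A *v vL = - b" using cramer[OF assms(7)] by blast
  obtain vS where vS: "?N *v vS = - b'" using cramer[OF detN] by blast

  \<comment> \<open>At the origin the difference is \<open>- c $ ?k\<close>, which is nonzero;
    continuity extends this to a neighbourhood, where the sliding field is defined.\<close>
  have "eventually (\<lambda>z. FL z $ ?k \<noteq> FR z $ ?k) (nhds (0, 0))"
  proof -
    have "continuous_on U (\<lambda>z. FL z $ ?k - FR z $ ?k)" by (intro continuous_intros contL contR)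
    then have "open ((\<lambda>z. FL z $ ?k - FR z $ ?k) -` (- {0}) \<inter> U)"
      using assms(1) continuous_on_open_vimage[OF assms(1)] by blast
    then have "eventually (\<lambda>z. z \<in> (\<lambda>z. FL z $ ?k - FR z $ ?k) -` (- {0}) \<inter> U) (nhds (0, 0))"
      using assms(2,9) by (intro eventually_nhds_in_open) (auto simp: FL0 FR0)
    then show ?thesis by eventually_elim auto
  qed
  then have pseudo: "eventually (\<lambda>z. ?H z = 0 \<longrightarrow> pseudo_equilibrium FL FR (fst z) (snd z)) (nhds (0, 0))"
    by eventually_elim (use assms(9) in \<open>blast intro: sliding_zero_field_imp_pseudo_equilibrium\<close>)

  have xL: "(\<lambda>\<mu>. norm (xL \<mu> - \<mu> *\<^sub>R vL)) \<in> O[nhds 0](\<lambda>\<mu>. \<mu>\<^sup>2)"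
    by (rule branch_linearization[OF assms(1,2) contL assms(7) FL _ assms(10) vL])
       (simp add: regular_equilibrium_def)
  have xS: "(\<lambda>\<mu>. norm (xS \<mu> - \<mu> *\<^sub>R vS)) \<in> O[nhds 0](\<lambda>\<mu>. \<mu>\<^sup>2)"
    by (rule branch_linearization[OF assms(1,2) continuous_on_sliding_zero_field[OF contL contR] detN
          sliding_zero_field_linearization[OF FL FR assms(9), folded b'_def] pseudo assms(11) vS])

  have "(\<lambda>\<mu>. xL \<mu> $ ?k - vL $ ?k * \<mu>) \<in> O[nhds 0](\<lambda>\<mu>. \<mu>\<^sup>2)"
    using xL unfolding bigo_vec_iff by (simp add: mult.commute)
  from linear_coefficient_unique[OF assms(12) this] have \<alpha>L: "\<alpha>L = vL $ ?k" .

  note Z = bigo_branch_point[OF xS]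
  \<comment> \<open>\<open>s\<close> is the first-order coefficient of the first component of
    \<open>FL\<close> along the sliding branch, obtained by inserting
    \<open>\<mu> *\<^sub>R vS\<close> into the linear part.\<close>
  define s where "s = (A *v vS + b) $ ?k"
  have "(\<lambda>\<mu>. FL (xS \<mu>, \<mu>) $ ?k - s * \<mu>) \<in> O[nhds 0](\<lambda>\<mu>. \<mu>\<^sup>2)"
  proof -
    have "(\<lambda>\<mu>. (norm (xS \<mu>, \<mu>))\<^sup>2) \<in> O[nhds 0](\<lambda>\<mu>. \<mu>\<^sup>2)"
      using landau_o.big.mult[OF Z(1) Z(1)] by (simp add: power2_eq_square)
    with landau_o.big.compose[OF FL Z(2)]
    have "(\<lambda>\<mu>. norm (FL (xS \<mu>, \<mu>) - (A *v xS \<mu> + \<mu> *\<^sub>R b))) \<in> O[nhds 0](\<lambda>\<mu>. \<mu>\<^sup>2)"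
      by (auto intro: landau_o.big_trans)
    moreover have "(\<lambda>\<mu>. norm (A *v (xS \<mu> - \<mu> *\<^sub>R vS))) \<in> O[nhds 0](\<lambda>\<mu>. \<mu>\<^sup>2)"
    proof (rule landau_o.big_trans[OF _ xS])
      obtain L where "\<And>y. norm (A *v y) \<le> L * norm y"
        using linear_bounded[OF matrix_vector_mul_linear, of A] by blast
      then show "(\<lambda>\<mu>. norm (A *v (xS \<mu> - \<mu> *\<^sub>R vS))) \<in> O[nhds 0](\<lambda>\<mu>. norm (xS \<mu> - \<mu> *\<^sub>R vS))"
        by (intro bigoI[of _ L]) simp
    qed
    ultimately have "(\<lambda>\<mu>. (FL (xS \<mu>, \<mu>) - (A *v xS \<mu> + \<mu> *\<^sub>R b)) $ ?k + (A *v (xS \<mu> - \<mu> *\<^sub>R vS)) $ ?k)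
        \<in> O[nhds 0](\<lambda>\<mu>. \<mu>\<^sup>2)"
      unfolding bigo_vec_iff by (intro sum_in_bigo) auto
    then show ?thesis
      by (simp add: s_def matrix_vector_mult_diff_distrib matrix_vector_mult_scaleR algebra_simps)
  qed
  \<comment> \<open>In the product \<open>chi\<close> only the constant term \<open>c $ ?k\<close>
    of this factor matters to first order, since the other factor is already
    \<open>O(\<mu>)\<close>.\<close>
  moreover have "(\<lambda>\<mu>. FR (xS \<mu>, \<mu>) $ ?k - c $ ?k) \<in> O[nhds 0](\<lambda>\<mu>. \<mu>)"
    using landau_o.big_trans[OF landau_o.big.compose[OF FR Z(2)] Z(1)] unfolding bigo_vec_iff by simp
  moreover have "(\<lambda>\<mu>::real. \<mu>) \<in> O[nhds 0](\<lambda>_. 1)"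
    by (rule bigoI_tendsto[of _ _ 0]) (auto intro!: filterlim_ident)
  ultimately have "(\<lambda>\<mu>. FL (xS \<mu>, \<mu>) $ ?k * FR (xS \<mu>, \<mu>) $ ?k - s * \<mu> * c $ ?k) \<in> O[nhds 0](\<lambda>\<mu>. \<mu>\<^sup>2)"
    by (intro bigo_mult_linearization) auto
  then have "(\<lambda>\<mu>. chi FL FR (xS \<mu>, \<mu>) - (c $ ?k * s) * \<mu>) \<in> O[nhds 0](\<lambda>\<mu>. \<mu>\<^sup>2)"
    by (simp add: chi_def mult_ac)
  from linear_coefficient_unique[OF assms(13) this] have \<alpha>S: "\<alpha>S = c $ ?k * s" .

  show ?thesis
    using sgn_branch_coefficients[OF assms(7,8,9) vL _ vS[unfolded b'_def]] assms(14)
    by (simp add: \<alpha>L \<alpha>S s_def)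
qed

end
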